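(* Let $(X,d)$ be an infinite metric space and let $\mathfrak{B}$ be a bornology on $X$ with closed base, $X\notin\mathfrak{B}$. The following statements are equivalent: (1) $(C(X),\tau_{\mathfrak{B}}^s)$ has countable $T$-tightness. (2) For each uncountable regular cardinal $\rho$ and each increasing sequence $\{\mathcal{U}_\alpha:\alpha<\rho\}$ of families of open subsets of $X$ such that $\bigcup_{\alpha<\rho}\mathcal{U}_\alpha$ is an open $\mathfrak{B}^s$-cover of $X$, there is a $\beta<\rho$ such that $\mathcal{U}_\beta$ is an open $\mathfrak{B}^s$-cover of $X$.
   Context: A bornology $\mathfrak{B}$ on $X$ is a family of subsets of $X$ that is closed under finite unions, hereditary (closed under taking subsets), and covers $X$. A base of $\mathfrak{B}$ is a subfamily of $\mathfrak{B}$ cofinal with respect to inclusion; it is closed if all its members are closed in $X$. For $B\in\mathfrak{B}$ and $\delta>0$, $B^\delta=\bigcup_{x\in B}\{y\in X: d(x,y)<\delta\}$. All open covers of $X$ are assumed to be countably infinite. An open $\mathfrak{B}^s$-cover of $X$ is an open cover $\mathcal{U}$ with $X\notin\mathcal{U}$ such that for each $B\in\mathfrak{B}$ there are $U\in\mathcal{U}$ and $\delta>0$ with $B^\delta\subseteq U$. $C(X)$ is the set of continuous functions $X\to\mathbb{R}$. The topology $\tau_{\mathfrak{B}}^s$ of strong uniform convergence on $\mathfrak{B}$ on $C(X)$ is the one in which the basic neighbourhoods of $f\in C(X)$ are the sets $[B,\varepsilon]^s(f)=\{g\in C(X):\exists\delta>0\ \forall x\in B^\delta,\ |f(x)-g(x)|<\varepsilon\}$,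 for $B\in\mathfrak{B}$ and $\varepsilon>0$. A topological space $Z$ has countable $T$-tightness if for each uncountable regular cardinal $\rho$ and each increasing sequence $\{A_\alpha:\alpha<\rho\}$ of closed subsets of $Z$ the set $\bigcup\{A_\alpha:\alpha<\rho\}$ is closed.
   Formalization: Open covers may have any infinite cardinality: with the convention that covers are countable, (2) always holds while (1) fails for the discrete space of size ω₁ with finite sets. Cardinals ρ range over a fixed large enough type, which loses nothing since longer sequences stabilize. *)

theory Defs
  imports "HOL-Analysis.Analysis"
begin

unbundle cardinal_syntax

section \<open>Bornologies and covers\<close>

definition bornology :: "'a set set \<Rightarrow> bool" where
  "bornology \<BB> \<longleftrightarrow>
     (\<forall>\<F>. finite \<F> \<and> \<F> \<subseteq> \<BB> \<longrightarrow> \<Union>\<F> \<in> \<BB>) \<and>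
     (\<forall>B\<in>\<BB>. \<forall>A. A \<subseteq> B \<longrightarrow> A \<in> \<BB>) \<and>
     \<Union>\<BB> = UNIV"

lemma bornology_Union: "bornology \<BB> \<Longrightarrow> finite \<F> \<Longrightarrow> \<F> \<subseteq> \<BB> \<Longrightarrow> \<Union>\<F> \<in> \<BB>"
  by (simp add: bornology_def)

lemma bornology_subset: "bornology \<BB> \<Longrightarrow> B \<in> \<BB> \<Longrightarrow> A \<subseteq> B \<Longrightarrow> A \<in> \<BB>"
  by (simp add: bornology_def)

lemma bornology_Un: "bornology \<BB> \<Longrightarrow> A \<in> \<BB> \<Longrightarrow> B \<in> \<BB> \<Longrightarrow> A \<union> B \<in> \<BB>"
  using bornology_Union[of \<BB> "{A, B}"] by simp

lemma bornology_covers: "bornology \<BB> \<Longrightarrow> \<exists>B\<in>\<BB>. x \<in> B"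
  unfolding bornology_def by (metis UNIV_I Union_iff)

definition bornology_base :: "'a set set \<Rightarrow> 'a set set \<Rightarrow> bool" where
  "bornology_base \<BB> \<BB>\<^sub>0 \<longleftrightarrow> \<BB>\<^sub>0 \<subseteq> \<BB> \<and> (\<forall>B\<in>\<BB>. \<exists>B'\<in>\<BB>\<^sub>0. B \<subseteq> B')"

definition has_closed_base :: "'a::topological_space set set \<Rightarrow> bool" where
  "has_closed_base \<BB> \<longleftrightarrow> (\<exists>\<BB>\<^sub>0. bornology_base \<BB> \<BB>\<^sub>0 \<and> (\<forall>B\<in>\<BB>\<^sub>0. closed B))"

definition enlargement :: "'a::metric_space set \<Rightarrow> real \<Rightarrow> 'a set" where
  "enlargement B \<delta> = (\<Union>x\<in>B. ball x \<delta>)"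

text \<open>
  Covers are infinite, but of arbitrary cardinality. Countability is deliberately not imposed: an
  increasing sequence of subfamilies indexed by an uncountable regular cardinal whose union is
  countable is eventually equal to that union, so with countable covers the covering condition
  characterizing countable T-tightness would hold in every space.
\<close>

definition open_cover :: "'a::topological_space set set \<Rightarrow> bool" where
  "open_cover \<U> \<longleftrightarrow> infinite \<U> \<and> (\<forall>U\<in>\<U>. open U) \<and> \<Union>\<U> = UNIV"

definition open_Bs_cover :: "'a::metric_space set set \<Rightarrow> 'a set set \<Rightarrow> bool" where
  "open_Bs_cover \<BB> \<U> \<longleftrightarrow>
     open_cover \<U> \<and> UNIV \<notin> \<U> \<and>
     (\<forall>B\<in>\<BB>. \<exists>U\<in>\<U>. \<exists>\<delta>>0. enlargement B \<delta> \<subseteq> U)"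

text \<open>The infinitude clause is automatic.\<close>

lemma open_Bs_cover_iff:
  assumes "bornology \<BB>"
  shows "open_Bs_cover \<BB> \<U> \<longleftrightarrow>
     (\<forall>U\<in>\<U>. open U) \<and> \<Union>\<U> = UNIV \<and> UNIV \<notin> \<U> \<and>
     (\<forall>B\<in>\<BB>. \<exists>U\<in>\<U>. \<exists>\<delta>>0. enlargement B \<delta> \<subseteq> U)"
proof -
  have "infinite \<U>" if U: "UNIV \<notin> \<U>" and
    c: "\<forall>B\<in>\<BB>. \<exists>U\<in>\<U>. \<exists>\<delta>>0. enlargement B \<delta> \<subseteq> U"
  proof
    assume fin: "finite \<U>"
    have "\<forall>U\<in>\<U>. \<exists>x. x \<notin> U" using U by (metis UNIV_eq_I)
    then obtain p where p: "\<And>U. U \<in> \<U> \<Longrightarrow> p U \<notin> U" by metis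
    have sing: "{x} \<in> \<BB>" for x
    proof -
      obtain B where "B \<in> \<BB>" "x \<in> B" using bornology_covers[OF assms] by metis
      then show ?thesis using bornology_subset[OF assms, of B "{x}"] by simp
    qed
    have "\<Union>((\<lambda>U. {p U}) ` \<U>) \<in> \<BB>"
      using bornology_Union[OF assms finite_imageI[OF fin] image_subsetI] sing by simp
    then obtain U \<delta> where "U \<in> \<U>" "\<delta> > 0" "enlargement (\<Union>((\<lambda>U. {p U}) ` \<U>)) \<delta> \<subseteq> U"
      using c by metis
    then have "p U \<in> U" unfolding enlargement_def by force
    with p \<open>U \<in> \<U>\<close> show False by blast
  qed
  then show ?thesis unfolding open_Bs_cover_def open_cover_def by blast
qed

section \<open>Strong uniform convergence on a bornology\<close>

definition cont_funs :: "('a::topological_space \<Rightarrow> real) set" where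
  "cont_funs = {f. continuous_on UNIV f}"

definition strong_nbhd :: "'a::metric_space set \<Rightarrow> real \<Rightarrow> ('a \<Rightarrow> real) \<Rightarrow> ('a \<Rightarrow> real) set" where
  "strong_nbhd B \<epsilon> f =
     {g \<in> cont_funs. \<exists>\<delta>>0. \<forall>x\<in>enlargement B \<delta>. \<bar>f x - g x\<bar> < \<epsilon>}"

definition strong_open :: "'a::metric_space set set \<Rightarrow> ('a \<Rightarrow> real) set \<Rightarrow> bool" where
  "strong_open \<BB> W \<longleftrightarrow>
     W \<subseteq> cont_funs \<and> (\<forall>f\<in>W. \<exists>B\<in>\<BB>. \<exists>\<epsilon>>0. strong_nbhd B \<epsilon> f \<subseteq> W)"

definition strong_uniform_topology :: "'a::metric_space set set \<Rightarrow> ('a \<Rightarrow> real) topology" where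
  "strong_uniform_topology \<BB> = topology (strong_open \<BB>)"

lemma strong_openD:
  assumes "strong_open \<BB> W" "f \<in> W"
  obtains B \<epsilon> where "B \<in> \<BB>" "\<epsilon> > 0" "strong_nbhd B \<epsilon> f \<subseteq> W"
  using assms unfolding strong_open_def by meson

lemma strong_openI:
  assumes "W \<subseteq> cont_funs"
    and "\<And>f. f \<in> W \<Longrightarrow> \<exists>B\<in>\<BB>. \<exists>\<epsilon>>0. strong_nbhd B \<epsilon> f \<subseteq> W"
  shows "strong_open \<BB> W"
  using assms unfolding strong_open_def by simp

lemma strong_open_subset: "strong_open \<BB> W \<Longrightarrow> W \<subseteq> cont_funs"
  by (simp add: strong_open_def)

lemma strong_nbhd_mono:
  assumes "B \<subseteq> B'" "\<epsilon>' \<le> \<epsilon>"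
  shows "strong_nbhd B' \<epsilon>' f \<subseteq> strong_nbhd B \<epsilon> f"
proof
  fix g assume "g \<in> strong_nbhd B' \<epsilon>' f"
  then obtain \<delta> where g: "g \<in> cont_funs" and d: "\<delta> > 0"
    and *: "\<And>x. x \<in> enlargement B' \<delta> \<Longrightarrow> \<bar>f x - g x\<bar> < \<epsilon>'"
    unfolding strong_nbhd_def by blast
  have "\<bar>f x - g x\<bar> < \<epsilon>" if "x \<in> enlargement B \<delta>" for x
  proof -
    have "x \<in> enlargement B' \<delta>" using that assms(1) unfolding enlargement_def by blast
    from *[OF this] assms(2) show ?thesis by linarith
  qed
  with g d show "g \<in> strong_nbhd B \<epsilon> f" unfolding strong_nbhd_def by blast
qed

lemma istopology_strong_open:
  assumes "bornology \<BB>"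
  shows "istopology (strong_open \<BB>)"
  unfolding istopology_def
proof (intro conjI allI impI)
  fix S T assume S: "strong_open \<BB> S" and T: "strong_open \<BB> T"
  have "\<exists>B\<in>\<BB>. \<exists>\<epsilon>>0. strong_nbhd B \<epsilon> f \<subseteq> S \<inter> T" if fST: "f \<in> S \<inter> T" for f
  proof -
    obtain B1 e1 where 1: "B1 \<in> \<BB>" "e1 > 0" "strong_nbhd B1 e1 f \<subseteq> S"
      using strong_openD[OF S] fST by blast
    obtain B2 e2 where 2: "B2 \<in> \<BB>" "e2 > 0" "strong_nbhd B2 e2 f \<subseteq> T"
      using strong_openD[OF T] fST by blast
    have "B1 \<union> B2 \<in> \<BB>" using bornology_Un[OF assms 1(1) 2(1)] .
    moreover have "strong_nbhd (B1 \<union> B2) (min e1 e2) f \<subseteq> S \<inter> T"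
      using strong_nbhd_mono[of B1 "B1 \<union> B2" "min e1 e2" e1 f]
        strong_nbhd_mono[of B2 "B1 \<union> B2" "min e1 e2" e2 f] 1 2 by auto
    moreover have "min e1 e2 > 0" using 1 2 by simp
    ultimately show ?thesis by blast
  qed
  moreover have "S \<inter> T \<subseteq> cont_funs" using strong_open_subset[OF S] by auto
  ultimately show "strong_open \<BB> (S \<inter> T)" by (rule strong_openI[rotated])
next
  fix K assume K: "\<forall>S\<in>K. strong_open \<BB> S"
  show "strong_open \<BB> (\<Union>K)"
  proof (rule strong_openI)
    show "\<Union>K \<subseteq> cont_funs" using K strong_open_subset by auto
    fix f assume "f \<in> \<Union>K"
    then obtain S where S: "S \<in> K" "f \<in> S" by auto
    obtain B \<epsilon> where "B \<in> \<BB>" "\<epsilon> > 0" "strong_nbhd B \<epsilon> f \<subseteq> S"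
      using strong_openD[of \<BB> S f] K S by metis
    moreover have "S \<subseteq> \<Union>K" using S by auto
    ultimately show "\<exists>B\<in>\<BB>. \<exists>\<epsilon>>0. strong_nbhd B \<epsilon> f \<subseteq> \<Union>K" by (meson order_trans)
  qed
qed

lemma openin_strong_uniform_topology:
  assumes "bornology \<BB>"
  shows "openin (strong_uniform_topology \<BB>) W \<longleftrightarrow> strong_open \<BB> W"
  using istopology_strong_open[OF assms]
  by (simp add: strong_uniform_topology_def topology_inverse')

lemma topspace_strong_uniform_topology:
  assumes "bornology \<BB>"
  shows "topspace (strong_uniform_topology \<BB>) = cont_funs"
proof -
  obtain B where B: "B \<in> \<BB>" using bornology_covers[OF assms] by metis
  have "strong_nbhd B 1 f \<subseteq> cont_funs" for f unfolding strong_nbhd_def by simp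
  with B have "strong_open \<BB> cont_funs"
    using zero_less_one by (intro strong_openI) blast+
  then show ?thesis
    unfolding topspace_def openin_strong_uniform_topology[OF assms]
    using strong_open_subset by auto
qed

text \<open>The sets \<^const>\<open>strong_nbhd\<close> are neighbourhoods (in general not open ones).\<close>

lemma strong_nbhd_is_nbhd:
  assumes "bornology \<BB>" "B \<in> \<BB>" "\<epsilon> > 0" "f \<in> cont_funs"
  shows "\<exists>W. openin (strong_uniform_topology \<BB>) W \<and> f \<in> W \<and> W \<subseteq> strong_nbhd B \<epsilon> f"
proof -
  define W where "W = (\<Union>\<epsilon>'\<in>{0<..<\<epsilon>}. strong_nbhd B \<epsilon>' f)"
  have "\<exists>B\<in>\<BB>. \<exists>\<eta>>0. strong_nbhd B \<eta> g \<subseteq> W" if gW: "g \<in> W" for g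
  proof -
    obtain e where e0: "0 < e" "e < \<epsilon>" and "g \<in> strong_nbhd B e f"
      using gW unfolding W_def by auto
    then obtain d where "d > 0" and fg: "\<And>x. x \<in> enlargement B d \<Longrightarrow> \<bar>f x - g x\<bar> < e"
      unfolding strong_nbhd_def by auto
    note e = e0 \<open>d > 0\<close>
    define h where "h = (\<epsilon> - e) / 2"
    have h: "h > 0" "e + h < \<epsilon>" using e unfolding h_def by (auto simp: field_simps)
    have "k \<in> W" if kB: "k \<in> strong_nbhd B h g" for k
    proof -
      obtain d' where k: "k \<in> cont_funs" "d' > 0"
        and gk: "\<And>x. x \<in> enlargement B d' \<Longrightarrow> \<bar>g x - k x\<bar> < h"
        using kB unfolding strong_nbhd_def by auto
      have "\<bar>f x - k x\<bar> < e + h" if x: "x \<in> enlargement B (min d d')" for x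
      proof -
        have "x \<in> enlargement B d" "x \<in> enlargement B d'"
          using x unfolding enlargement_def by auto
        from fg[OF this(1)] gk[OF this(2)] show ?thesis by linarith
      qed
      then have "k \<in> strong_nbhd B (e + h) f"
        using k e unfolding strong_nbhd_def by (auto intro!: exI[of _ "min d d'"])
      then show ?thesis using e h unfolding W_def by auto
    qed
    then have "strong_nbhd B h g \<subseteq> W" by auto
    then show ?thesis using h(1) assms(2) by metis
  qed
  moreover have "W \<subseteq> cont_funs" unfolding W_def strong_nbhd_def by auto
  ultimately have "strong_open \<BB> W" by (rule strong_openI[rotated])
  moreover have "f \<in> strong_nbhd B (\<epsilon>/2) f"
    using assms unfolding strong_nbhd_def by (auto intro!: exI[of _ 1])
  then have "f \<in> W" unfolding W_def using assms(3) by (auto intro!: bexI[of _ "\<epsilon>/2"])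
  moreover have "W \<subseteq> strong_nbhd B \<epsilon> f"
    unfolding W_def by (intro UN_least strong_nbhd_mono) auto
  ultimately show ?thesis using openin_strong_uniform_topology[OF assms(1)] by blast
qed

section \<open>Uncountable regular cardinals and countable T-tightness\<close>

definition uncountable_regular :: "'r rel \<Rightarrow> bool" where
  "uncountable_regular r \<longleftrightarrow> Card_order r \<and> natLeq <o r \<and> regularCard r"

text \<open>
  Cardinals are well-orders, so \<open>i \<in> Field r\<close> plays the role of \<open>\<alpha> < \<rho>\<close>. A cardinal occurring inside
  a formula needs a fixed type; for increasing sequences of subsets of a type \<open>'e\<close> it suffices to
  let it range over the cardinals on \<open>'e\<close> itself, since a sequence indexed by a larger regular
  cardinal is eventually constant. The lemma \<open>countably_T_tightD\<close> below (and
  \<open>regular_chain_cover\<close> for the covering condition) recovers cardinals on arbitrary types.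
\<close>

definition countably_T_tight :: "'z topology \<Rightarrow> bool" where
  "countably_T_tight Z \<longleftrightarrow>
     (\<forall>(r::'z rel) A.
        uncountable_regular r \<and> relChain r A \<and> (\<forall>i\<in>Field r. closedin Z (A i)) \<longrightarrow>
        closedin Z (\<Union>i\<in>Field r. A i))"

lemma regular_chain_cases:
  fixes r :: "'r rel" and A :: "'r \<Rightarrow> 'e set"
  assumes r: "uncountable_regular r" and A: "relChain r A"
  obtains (const) i where "i \<in> Field r" "(\<Union>i\<in>Field r. A i) = A i"
  | (transfer) r' :: "'e rel" and g where "uncountable_regular r'" "relChain r' (\<lambda>j. A (g j))"
      "g ` Field r' = Field r"
proof (cases "|UNIV::'e set| <o r")
  case True
  have "|\<Union>i\<in>Field r. A i| <o r"
    using True card_of_mono1[OF subset_UNIV] ordLeq_ordLess_trans by blast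
  then obtain i where "i \<in> Field r" "(\<Union>i\<in>Field r. A i) \<subseteq> A i"
    using regularCard_UNION[of r A "\<Union>i\<in>Field r. A i"] r A
    unfolding uncountable_regular_def by auto
  then show ?thesis using const by blast
next
  case False
  have co: "Card_order r" and un: "natLeq <o r" and reg: "regularCard r"
    using r unfolding uncountable_regular_def by auto
  have wo: "Well_order r" using co card_order_on_well_order_on by blast
  have "r \<le>o |UNIV::'e set|"
    using False wo card_of_Well_order not_ordLess_iff_ordLeq by blast
  then have "|Field r| \<le>o |UNIV::'e set|"
    using card_of_Field_ordIso[OF co] ordIso_ordLeq_trans by blast
  then obtain f :: "'r \<Rightarrow> 'e" where f: "inj_on f (Field r)"
    using card_of_ordLeq[of "Field r" "UNIV::'e set"] by auto
  define r' where "r' = dir_image r f"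
  have iso: "r =o r'" unfolding r'_def using dir_image_ordIso[OF wo f] .
  have co': "Card_order r'" using Card_order_ordIso2[OF co iso] .
  have un': "natLeq <o r'" using un iso ordLess_ordIso_trans by blast
  have ci: "Cinfinite r"
    using co un natLeq_ordLeq_cinfinite ordLess_imp_ordLeq natLeq_Cinfinite cinfinite_mono
    by blast
  have reg': "regularCard r'" using regularCard_ordIso[OF iso ci reg] .
  define g where "g = the_inv_into (Field r) f"
  have gf: "g (f i) = i" if "i \<in> Field r" for i
    unfolding g_def using the_inv_into_f_f[OF f that] .
  have "g ` Field r' = Field r"
    unfolding r'_def dir_image_Field using gf by force
  moreover have "relChain r' (\<lambda>j. A (g j))"
    unfolding relChain_def
  proof (intro allI impI)
    fix i j assume "(i, j) \<in> r'"
    then obtain a b where ab: "i = f a" "j = f b" "(a, b) \<in> r"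
      unfolding r'_def dir_image_def by auto
    then have "a \<in> Field r" "b \<in> Field r" by (auto simp: Field_def)
    then show "A (g i) \<subseteq> A (g j)" using A ab gf unfolding relChain_def by simp
  qed
  ultimately show ?thesis using transfer co' un' reg' unfolding uncountable_regular_def by blast
qed

lemma countably_T_tightD:
  fixes r :: "'r rel" and A :: "'r \<Rightarrow> 'z set"
  assumes "countably_T_tight Z" "uncountable_regular r" "relChain r A"
    and cl: "\<And>i. i \<in> Field r \<Longrightarrow> closedin Z (A i)"
  shows "closedin Z (\<Union>i\<in>Field r. A i)"
  using assms(2,3)
proof (cases rule: regular_chain_cases)
  case (const i)
  then show ?thesis using cl by simp
next
  case (transfer r' g)
  have "closedin Z (\<Union>j\<in>Field r'. A (g j))"
    using assms(1) transfer cl unfolding countably_T_tight_def by blast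
  moreover have "(\<Union>j\<in>Field r'. A (g j)) = (\<Union>i\<in>Field r. A i)"
    using transfer(3) by (metis image_image)
  ultimately show ?thesis by simp
qed

lemma regular_chain_cover:
  fixes r :: "'r rel" and \<U> :: "'r \<Rightarrow> 'a::metric_space set set"
  assumes "\<And>(r'::'a set rel) \<V>. uncountable_regular r' \<Longrightarrow> relChain r' \<V> \<Longrightarrow>
      (\<And>i V. i \<in> Field r' \<Longrightarrow> V \<in> \<V> i \<Longrightarrow> open V) \<Longrightarrow> open_Bs_cover \<BB> (\<Union>i\<in>Field r'. \<V> i) \<Longrightarrow>
      \<exists>i\<in>Field r'. open_Bs_cover \<BB> (\<V> i)"
    and "uncountable_regular r" "relChain r \<U>"
    and op: "\<And>i U. i \<in> Field r \<Longrightarrow> U \<in> \<U> i \<Longrightarrow> open U"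
    and cov: "open_Bs_cover \<BB> (\<Union>i\<in>Field r. \<U> i)"
  shows "\<exists>i\<in>Field r. open_Bs_cover \<BB> (\<U> i)"
  using assms(2,3)
proof (cases rule: regular_chain_cases)
  case (const i)
  then show ?thesis using cov by auto
next
  case (transfer r' g)
  have "(\<Union>j\<in>Field r'. \<U> (g j)) = (\<Union>i\<in>Field r. \<U> i)"
    using transfer(3) by (metis image_image)
  then have "\<exists>j\<in>Field r'. open_Bs_cover \<BB> (\<U> (g j))"
    using assms(1)[of r' "\<lambda>j. \<U> (g j)"] transfer op cov by (metis imageI)
  then show ?thesis using transfer(3) by blast
qed

end

theory Submission
  imports Defs
begin

text \<open>
  Both conditions say that something which happens along a whole increasing chain already happens
  at one stage, and functions translate into open sets by way of
  \<open>g \<mapsto> {x. \<bar>f x - g x\<bar> < \<epsilon>}\<close>: the function \<open>f\<close> lies in the closure of a set \<open>S\<close> of functions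
  exactly when, for every \<open>\<epsilon>\<close>, the sets \<open>{x. \<bar>f x - g x\<bar> < \<epsilon>}\<close> with \<open>g \<in> S\<close> absorb every
  member \<open>B\<close> of the bornology, in the sense that one of them contains an enlargement of \<open>B\<close>
  (\<open>closure_of_strong_uniform\<close>).

  From tightness to covers, attach to a family \<open>\<V>\<close> of open sets the functions that equal \<open>1\<close> outside
  some member of \<open>\<V>\<close>. If the zero function is a limit of such functions, then \<open>\<V>\<close> absorbs
  every \<open>B\<close>; the converse holds because a set \<open>B\<close> and the complement of \<open>enlargement B \<delta>\<close> lie at
  positive distance and so are separated by a function that vanishes on a whole enlargement of \<open>B\<close>.
  Tightness, applied to the closures of these sets of functions, locates the zero function in one
  of them (\<open>zero_in_closure_iff_absorbing\<close>).

  From covers to tightness, let \<open>f\<close> be in the closure of the union of a chain of closed sets \<open>A i\<close>.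
  For each precision \<open>1/(n+1)\<close> the covering condition yields a stage that approximates \<open>f\<close> with this
  precision near every member of the bornology. It applies unless the family of sets contains the
  whole space, but then some single function of the chain is uniformly close to \<open>f\<close>, and
  its stage will do. The index set has uncountable cofinality, so that one stage serves all \<open>n\<close>, and
  \<open>f\<close> belongs to it because it is closed.
\<close>

section \<open>Uncountable cofinality\<close>

text \<open>
  This is where the uncountability of the cardinal enters: countably many indices have a common
  upper bound.
\<close>

lemma uncountable_regular_uniform_index:
  fixes P :: "nat \<Rightarrow> 'r \<Rightarrow> bool"
  assumes r: "uncountable_regular r"
    and mono: "\<And>n i j. (i, j) \<in> r \<Longrightarrow> P n i \<Longrightarrow> P n j"
    and ex: "\<And>n. \<exists>i\<in>Field r. P n i"
  shows "\<exists>i\<in>Field r. \<forall>n. P n i"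
proof -
  have "relChain r (\<lambda>i. {n. P n i})"
    using mono unfolding relChain_def by auto
  moreover have "|UNIV :: nat set| <o r"
    using r card_of_nat ordIso_ordLess_trans unfolding uncountable_regular_def by blast
  moreover have "(UNIV :: nat set) \<subseteq> (\<Union>i\<in>Field r. {n. P n i})"
    using ex by auto
  ultimately have "\<exists>i\<in>Field r. (UNIV :: nat set) \<subseteq> {n. P n i}"
    using r regularCard_UNION[of r "\<lambda>i. {n. P n i}" UNIV]
    unfolding uncountable_regular_def by blast
  then show ?thesis by auto
qed

section \<open>Closures under strong uniform convergence\<close>

text \<open>
  The sets \<^const>\<open>strong_nbhd\<close> need not be open, but they form a neighbourhood base, which is enough
  to test membership in a closure.
\<close>

lemma closure_of_strong_uniform:
  assumes \<BB>: "bornology \<BB>" and f: "f \<in> cont_funs"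
  shows "f \<in> strong_uniform_topology \<BB> closure_of S \<longleftrightarrow>
    (\<forall>B\<in>\<BB>. \<forall>\<epsilon>>0. \<exists>g\<in>S. g \<in> strong_nbhd B \<epsilon> f)"
proof
  assume cl: "f \<in> strong_uniform_topology \<BB> closure_of S"
  show "\<forall>B\<in>\<BB>. \<forall>\<epsilon>>0. \<exists>g\<in>S. g \<in> strong_nbhd B \<epsilon> f"
  proof (intro ballI allI impI)
    fix B and \<epsilon> :: real assume "B \<in> \<BB>" "\<epsilon> > 0"
    then obtain W where "openin (strong_uniform_topology \<BB>) W" "f \<in> W" "W \<subseteq> strong_nbhd B \<epsilon> f"
      using strong_nbhd_is_nbhd[OF \<BB> _ _ f] by meson
    then show "\<exists>g\<in>S. g \<in> strong_nbhd B \<epsilon> f"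
      using cl unfolding in_closure_of by blast
  qed
next
  assume near: "\<forall>B\<in>\<BB>. \<forall>\<epsilon>>0. \<exists>g\<in>S. g \<in> strong_nbhd B \<epsilon> f"
  have "\<exists>g. g \<in> S \<and> g \<in> W" if fW: "f \<in> W" and W: "openin (strong_uniform_topology \<BB>) W" for W
  proof -
    have "strong_open \<BB> W"
      using W openin_strong_uniform_topology[OF \<BB>] by simp
    then obtain B \<epsilon> where "B \<in> \<BB>" "\<epsilon> > 0" "strong_nbhd B \<epsilon> f \<subseteq> W"
      using fW by (rule strong_openD)
    then show ?thesis using near by blast
  qed
  then show "f \<in> strong_uniform_topology \<BB> closure_of S"
    unfolding in_closure_of topspace_strong_uniform_topology[OF \<BB>] using f by blast
qed

section \<open>From tightness to covers\<close>

lemma subset_enlargement: "\<delta> > 0 \<Longrightarrow> B \<subseteq> enlargement B \<delta>"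
  unfolding enlargement_def by auto

text \<open>
  Halving the radius leaves room for the function to vanish on an enlargement of \<open>B\<close>, as a strong
  neighbourhood demands, and not merely on \<open>B\<close>.
\<close>

lemma enlargement_separation:
  fixes B :: "'a::metric_space set"
  assumes "\<delta> > 0" and sub: "enlargement B \<delta> \<subseteq> U"
  obtains g :: "'a \<Rightarrow> real" where "continuous_on UNIV g"
    and "\<And>x. x \<in> enlargement B (\<delta> / 2) \<Longrightarrow> g x = 0" and "\<And>x. x \<notin> U \<Longrightarrow> g x = 1"
proof (cases "B = {}")
  \<comment> \<open>The distance to the empty set is \<open>0\<close> by convention, so the formula below would give \<open>0\<close>.\<close>
  case True
  then show ?thesis by (intro that[of "\<lambda>_. 1"]) (auto simp: enlargement_def)
next
  case False
  \<comment> \<open>The distance to \<open>B\<close>, rescaled so that \<open>[\<delta>/2, \<delta>]\<close> becomes \<open>[0, 1]\<close>, and truncated.\<close>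
  define g where "g x = min 1 (max 0 (2 * infdist x B / \<delta> - 1))" for x
  have "continuous_on UNIV g"
    unfolding g_def using \<open>\<delta> > 0\<close> by (intro continuous_intros) auto
  moreover have "g x = 0" if x: "x \<in> enlargement B (\<delta> / 2)" for x
  proof -
    obtain b where "b \<in> B" "dist b x < \<delta> / 2"
      using x unfolding enlargement_def by auto
    then have "infdist x B \<le> \<delta> / 2"
      using infdist_le[of b B x] by (simp add: dist_commute)
    then show ?thesis using \<open>\<delta> > 0\<close> by (simp add: g_def field_simps)
  qed
  moreover have "g x = 1" if "x \<notin> U" for x
  proof -
    have "\<delta> \<le> dist x b" if "b \<in> B" for b
      using sub \<open>x \<notin> U\<close> that unfolding enlargement_def by (force simp: dist_commute not_less)
    then have "\<delta> \<le> infdist x B"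
      unfolding infdist_def using False by (auto intro: cINF_greatest)
    then show ?thesis using \<open>\<delta> > 0\<close> by (simp add: g_def field_simps)
  qed
  ultimately show ?thesis by (rule that)
qed

text \<open>
  A function that equals \<open>1\<close> outside \<open>U \<in> \<V>\<close> and is smaller than \<open>1\<close> on an enlargement of \<open>B\<close> forces
  that enlargement into \<open>U\<close>; conversely, \<open>enlargement_separation\<close> supplies such functions as soon as
  some member of \<open>\<V>\<close> contains an enlargement of \<open>B\<close>.
\<close>

lemma zero_in_closure_iff_absorbing:
  fixes \<BB> :: "'a::metric_space set set"
  assumes \<BB>: "bornology \<BB>"
  shows "(\<lambda>_. 0) \<in> strong_uniform_topology \<BB> closure_of
      {g \<in> cont_funs. \<exists>U\<in>\<V>. \<forall>x. x \<notin> U \<longrightarrow> g x = 1} \<longleftrightarrow>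
    (\<forall>B\<in>\<BB>. \<exists>U\<in>\<V>. \<exists>\<delta>>0. enlargement B \<delta> \<subseteq> U)"
    (is "_ \<in> _ closure_of ?S \<longleftrightarrow> ?absorbing")
proof -
  have zero: "(\<lambda>_::'a. 0::real) \<in> cont_funs" unfolding cont_funs_def by simp
  have absorb: "\<exists>U\<in>\<V>. \<exists>\<delta>>0. enlargement B \<delta> \<subseteq> U"
    if S: "g \<in> ?S" and lt_1: "g \<in> strong_nbhd B 1 (\<lambda>_. 0)" for g B
  proof -
    obtain U where U: "U \<in> \<V>" "\<And>x. x \<notin> U \<Longrightarrow> g x = 1" using S by blast
    obtain \<delta> where \<delta>: "\<delta> > 0" "\<And>x. x \<in> enlargement B \<delta> \<Longrightarrow> \<bar>g x\<bar> < 1"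
      using lt_1 unfolding strong_nbhd_def by auto
    have "enlargement B \<delta> \<subseteq> U" using U(2) \<delta>(2) by fastforce
    with U(1) \<delta>(1) show ?thesis by blast
  qed
  have approx: "\<exists>g\<in>?S. g \<in> strong_nbhd B \<epsilon> (\<lambda>_. 0)"
    if U: "U \<in> \<V>" and \<delta>: "\<delta> > 0" "enlargement B \<delta> \<subseteq> U" and "\<epsilon> > 0" for U \<delta> \<epsilon> B
  proof -
    obtain g :: "'a \<Rightarrow> real" where g: "continuous_on UNIV g"
      "\<And>x. x \<in> enlargement B (\<delta> / 2) \<Longrightarrow> g x = 0" "\<And>x. x \<notin> U \<Longrightarrow> g x = 1"
      using enlargement_separation[OF \<delta>] by blast
    have "g \<in> ?S" using g U unfolding cont_funs_def by blast
    moreover have "g \<in> strong_nbhd B \<epsilon> (\<lambda>_. 0)"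
      using g \<delta>(1) \<open>\<epsilon> > 0\<close> unfolding strong_nbhd_def cont_funs_def
      by (auto intro!: exI[of _ "\<delta> / 2"])
    ultimately show ?thesis by blast
  qed
  show ?thesis
    unfolding closure_of_strong_uniform[OF \<BB> zero]
  proof (intro iffI ballI allI impI)
    fix B assume "\<forall>B\<in>\<BB>. \<forall>\<epsilon>>0. \<exists>g\<in>?S. g \<in> strong_nbhd B \<epsilon> (\<lambda>_. 0)" "B \<in> \<BB>"
    then have "\<exists>g\<in>?S. g \<in> strong_nbhd B 1 (\<lambda>_. 0)"
      using zero_less_one by blast
    then obtain g where "g \<in> ?S" "g \<in> strong_nbhd B 1 (\<lambda>_. 0)" ..
    then show "\<exists>U\<in>\<V>. \<exists>\<delta>>0. enlargement B \<delta> \<subseteq> U" by (rule absorb)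
  next
    fix B and \<epsilon> :: real assume "?absorbing" "B \<in> \<BB>" "\<epsilon> > 0"
    then obtain U \<delta> where "U \<in> \<V>" "\<delta> > 0" "enlargement B \<delta> \<subseteq> U" by blast
    then show "\<exists>g\<in>?S. g \<in> strong_nbhd B \<epsilon> (\<lambda>_. 0)" using \<open>\<epsilon> > 0\<close> by (rule approx)
  qed
qed

lemma tight_imp_chain_cover:
  fixes \<BB> :: "'a::metric_space set set" and r :: "'r rel"
  assumes \<BB>: "bornology \<BB>"
    and tight: "countably_T_tight (strong_uniform_topology \<BB>)"
    and r: "uncountable_regular r" and chain: "relChain r \<U>"
    and cov: "open_Bs_cover \<BB> (\<Union>i\<in>Field r. \<U> i)"
  shows "\<exists>i\<in>Field r. open_Bs_cover \<BB> (\<U> i)"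
proof -
  let ?T = "strong_uniform_topology \<BB>"
  define S :: "'a set set \<Rightarrow> ('a \<Rightarrow> real) set"
    where "S \<V> = {g \<in> cont_funs. \<exists>U\<in>\<V>. \<forall>x. x \<notin> U \<longrightarrow> g x = 1}" for \<V>
  note zero_iff = zero_in_closure_iff_absorbing[OF \<BB>, folded S_def]
  have mono: "?T closure_of S \<V> \<subseteq> ?T closure_of S \<W>" if "\<V> \<subseteq> \<W>" for \<V> \<W>
    by (rule closure_of_mono) (use that in \<open>auto simp: S_def\<close>)
  have "relChain r (\<lambda>i. ?T closure_of S (\<U> i))"
    using chain mono unfolding relChain_def by blast
  then have closed: "closedin ?T (\<Union>i\<in>Field r. ?T closure_of S (\<U> i))"
    by (intro countably_T_tightD[OF tight r]) auto
  have "S (\<Union>i\<in>Field r. \<U> i) \<subseteq> (\<Union>i\<in>Field r. S (\<U> i))"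
    unfolding S_def by blast
  also have "\<dots> \<subseteq> (\<Union>i\<in>Field r. ?T closure_of S (\<U> i))"
    using closure_of_subset[of _ ?T] topspace_strong_uniform_topology[OF \<BB>]
    by (intro UN_mono) (auto simp: S_def)
  finally have "?T closure_of S (\<Union>i\<in>Field r. \<U> i) \<subseteq> (\<Union>i\<in>Field r. ?T closure_of S (\<U> i))"
    using closed by (rule closure_of_minimal)
  moreover have "(\<lambda>_. 0) \<in> ?T closure_of S (\<Union>i\<in>Field r. \<U> i)"
    using cov unfolding zero_iff open_Bs_cover_def by blast
  ultimately obtain i where i: "i \<in> Field r" "(\<lambda>_. 0) \<in> ?T closure_of S (\<U> i)" by blast
  then have absorb: "\<And>B. B \<in> \<BB> \<Longrightarrow> \<exists>U\<in>\<U> i. \<exists>\<delta>>0. enlargement B \<delta> \<subseteq> U"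
    unfolding zero_iff by blast
  have "\<exists>U\<in>\<U> i. x \<in> U" for x
  proof -
    obtain B where "B \<in> \<BB>" "x \<in> B" using bornology_covers[OF \<BB>] by blast
    with absorb[of B] show ?thesis using subset_enlargement[of _ B] by blast
  qed
  moreover have "\<forall>U\<in>\<U> i. open U" "UNIV \<notin> \<U> i"
    using cov i(1) unfolding open_Bs_cover_def open_cover_def by blast+
  ultimately have "open_Bs_cover \<BB> (\<U> i)"
    using absorb unfolding open_Bs_cover_iff[OF \<BB>] by blast
  with i(1) show ?thesis by blast
qed

section \<open>From covers to tightness\<close>

text \<open>
  One stage approximates \<open>f\<close> to a given precision \<open>\<epsilon>\<close> near all members of the bornology. A cover
  must not contain the whole space, which is why uniform \<open>\<epsilon>\<close>-approximation is split off.
\<close>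

lemma stage_of_given_precision:
  fixes \<BB> :: "'a::metric_space set set" and r :: "'r rel" and \<epsilon> :: real
  assumes \<BB>: "bornology \<BB>"
    and chain_cover: "\<And>\<U>. relChain r \<U> \<Longrightarrow> (\<And>i U. i \<in> Field r \<Longrightarrow> U \<in> \<U> i \<Longrightarrow> open U) \<Longrightarrow>
      open_Bs_cover \<BB> (\<Union>i\<in>Field r. \<U> i) \<Longrightarrow> \<exists>i\<in>Field r. open_Bs_cover \<BB> (\<U> i)"
    and chain: "relChain r A" and cont: "\<And>i. i \<in> Field r \<Longrightarrow> A i \<subseteq> cont_funs"
    and f: "f \<in> cont_funs" and "\<epsilon> > 0"
    and cl: "f \<in> strong_uniform_topology \<BB> closure_of (\<Union>i\<in>Field r. A i)"
  shows "\<exists>i\<in>Field r. \<forall>B\<in>\<BB>. \<exists>g\<in>A i. g \<in> strong_nbhd B \<epsilon> f"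
proof (cases "\<exists>i\<in>Field r. \<exists>g\<in>A i. \<forall>x. \<bar>f x - g x\<bar> < \<epsilon>")
  case True
  then obtain i g where "i \<in> Field r" "g \<in> A i" "\<forall>x. \<bar>f x - g x\<bar> < \<epsilon>" by blast
  moreover from this have "g \<in> strong_nbhd B \<epsilon> f" for B
    using cont unfolding strong_nbhd_def by (auto intro!: exI[of _ 1])
  ultimately show ?thesis by blast
next
  case False
  define V where "V g = {x. \<bar>f x - g x\<bar> < \<epsilon>}" for g
  have open_V: "open (V g)" if "i \<in> Field r" "g \<in> A i" for i g
  proof -
    have "continuous_on UNIV g" "continuous_on UNIV f"
      using cont that f unfolding cont_funs_def by auto
    then show ?thesis unfolding V_def by (intro open_Collect_less continuous_intros)
  qed
  have absorb: "\<exists>i\<in>Field r. \<exists>g\<in>A i. \<exists>\<delta>>0. enlargement B \<delta> \<subseteq> V g" if B: "B \<in> \<BB>" for B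
  proof -
    have "\<exists>g\<in>(\<Union>i\<in>Field r. A i). g \<in> strong_nbhd B \<epsilon> f"
      using cl B \<open>\<epsilon> > 0\<close> unfolding closure_of_strong_uniform[OF \<BB> f] by blast
    then show ?thesis unfolding strong_nbhd_def V_def by blast
  qed
  have "\<exists>i\<in>Field r. \<exists>g\<in>A i. x \<in> V g" for x
  proof -
    obtain B where "B \<in> \<BB>" "x \<in> B" using bornology_covers[OF \<BB>] by blast
    with absorb[of B] show ?thesis using subset_enlargement[of _ B] by blast
  qed
  then have "\<Union>(\<Union>i\<in>Field r. V ` A i) = UNIV" by blast
  moreover have "UNIV \<notin> (\<Union>i\<in>Field r. V ` A i)"
    using False unfolding V_def by blast
  moreover have "\<forall>U\<in>(\<Union>i\<in>Field r. V ` A i). open U"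
    using open_V by blast
  moreover have "\<forall>B\<in>\<BB>. \<exists>U\<in>(\<Union>i\<in>Field r. V ` A i). \<exists>\<delta>>0. enlargement B \<delta> \<subseteq> U"
  proof
    fix B assume "B \<in> \<BB>"
    from absorb[OF this] show "\<exists>U\<in>(\<Union>i\<in>Field r. V ` A i). \<exists>\<delta>>0. enlargement B \<delta> \<subseteq> U"
      by blast
  qed
  ultimately have "open_Bs_cover \<BB> (\<Union>i\<in>Field r. V ` A i)"
    unfolding open_Bs_cover_iff[OF \<BB>] by (intro conjI)
  moreover have "relChain r (\<lambda>i. V ` A i)"
    using chain unfolding relChain_def by blast
  ultimately obtain i where i: "i \<in> Field r" "open_Bs_cover \<BB> (V ` A i)"
    using chain_cover[of "\<lambda>i. V ` A i"] open_V by blast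
  have "\<exists>g\<in>A i. g \<in> strong_nbhd B \<epsilon> f" if B: "B \<in> \<BB>" for B
  proof -
    obtain g \<delta> where "g \<in> A i" "\<delta> > 0" "enlargement B \<delta> \<subseteq> V g"
      using i(2) B unfolding open_Bs_cover_def by blast
    then show ?thesis using cont[OF i(1)] unfolding strong_nbhd_def V_def by blast
  qed
  with i(1) show ?thesis by blast
qed

lemma chain_cover_imp_closed_Union:
  fixes \<BB> :: "'a::metric_space set set" and r :: "'r rel"
  assumes \<BB>: "bornology \<BB>" and r: "uncountable_regular r"
    and chain_cover: "\<And>\<U>. relChain r \<U> \<Longrightarrow> (\<And>i U. i \<in> Field r \<Longrightarrow> U \<in> \<U> i \<Longrightarrow> open U) \<Longrightarrow>
      open_Bs_cover \<BB> (\<Union>i\<in>Field r. \<U> i) \<Longrightarrow> \<exists>i\<in>Field r. open_Bs_cover \<BB> (\<U> i)"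
    and chain: "relChain r A"
    and closed: "\<And>i. i \<in> Field r \<Longrightarrow> closedin (strong_uniform_topology \<BB>) (A i)"
  shows "closedin (strong_uniform_topology \<BB>) (\<Union>i\<in>Field r. A i)"
proof -
  let ?T = "strong_uniform_topology \<BB>"
  have cont: "A i \<subseteq> cont_funs" if "i \<in> Field r" for i
    using closedin_subset[OF closed[OF that]] topspace_strong_uniform_topology[OF \<BB>] by simp
  have "f \<in> (\<Union>i\<in>Field r. A i)" if cl: "f \<in> ?T closure_of (\<Union>i\<in>Field r. A i)" for f
  proof -
    have f: "f \<in> cont_funs"
      using cl closure_of_subset_topspace[of ?T] topspace_strong_uniform_topology[OF \<BB>] by blast
    have "\<exists>i\<in>Field r. \<forall>n. \<forall>B\<in>\<BB>. \<exists>g\<in>A i. g \<in> strong_nbhd B (inverse (real (Suc n))) f"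
    proof (rule uncountable_regular_uniform_index[OF r])
      show "\<forall>B\<in>\<BB>. \<exists>g\<in>A j. g \<in> strong_nbhd B (inverse (real (Suc n))) f"
        if "(i, j) \<in> r" "\<forall>B\<in>\<BB>. \<exists>g\<in>A i. g \<in> strong_nbhd B (inverse (real (Suc n))) f" for n i j
        using chain that unfolding relChain_def by blast
      show "\<exists>i\<in>Field r. \<forall>B\<in>\<BB>. \<exists>g\<in>A i. g \<in> strong_nbhd B (inverse (real (Suc n))) f" for n
        by (rule stage_of_given_precision[OF \<BB> chain_cover chain cont f _ cl]) auto
    qed
    then obtain i where i: "i \<in> Field r"
      and near: "\<And>n B. B \<in> \<BB> \<Longrightarrow> \<exists>g\<in>A i. g \<in> strong_nbhd B (inverse (real (Suc n))) f" by blast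
    have "\<exists>g\<in>A i. g \<in> strong_nbhd B \<epsilon> f" if "B \<in> \<BB>" "\<epsilon> > 0" for B \<epsilon>
    proof -
      obtain n where "inverse (real (Suc n)) < \<epsilon>" using reals_Archimedean[OF \<open>\<epsilon> > 0\<close>] by blast
      then have "strong_nbhd B (inverse (real (Suc n))) f \<subseteq> strong_nbhd B \<epsilon> f"
        by (intro strong_nbhd_mono) auto
      then show ?thesis using near[OF \<open>B \<in> \<BB>\<close>, of n] by blast
    qed
    then have "f \<in> ?T closure_of A i"
      unfolding closure_of_strong_uniform[OF \<BB> f] by blast
    then show ?thesis using closed[OF i] i closure_of_closedin by blast
  qed
  moreover have "(\<Union>i\<in>Field r. A i) \<subseteq> topspace ?T"
    using cont topspace_strong_uniform_topology[OF \<BB>] by blast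
  ultimately show ?thesis
    unfolding closure_of_subset_eq[symmetric] by blast
qed

section \<open>The equivalence\<close>

text \<open>
  The two conditions quantify over cardinals on different types. The two implications hold for
  chains over any fixed index type; in the direction from covers to tightness,
  \<open>regular_chain_cover\<close> carries the covering condition from cardinals on sets of points to
  cardinals on functions.
\<close>

theorem theorem5p2:
  fixes \<BB> :: "'a::metric_space set set"
  assumes "infinite (UNIV :: 'a set)"
    and "bornology \<BB>"
    and "has_closed_base \<BB>"
    and "UNIV \<notin> \<BB>"
  shows "countably_T_tight (strong_uniform_topology \<BB>) \<longleftrightarrow>
    (\<forall>(r :: 'a set rel) \<U>.
       uncountable_regular r \<and> relChain r \<U> \<and>
       (\<forall>i\<in>Field r. \<forall>U\<in>\<U> i. open U) \<and>
       open_Bs_cover \<BB> (\<Union>i\<in>Field r. \<U> i) \<longrightarrow>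
       (\<exists>i\<in>Field r. open_Bs_cover \<BB> (\<U> i)))"
proof
  assume tight: "countably_T_tight (strong_uniform_topology \<BB>)"
  show "\<forall>(r :: 'a set rel) \<U>.
       uncountable_regular r \<and> relChain r \<U> \<and>
       (\<forall>i\<in>Field r. \<forall>U\<in>\<U> i. open U) \<and>
       open_Bs_cover \<BB> (\<Union>i\<in>Field r. \<U> i) \<longrightarrow>
       (\<exists>i\<in>Field r. open_Bs_cover \<BB> (\<U> i))"
    by (intro allI impI, elim conjE) (rule tight_imp_chain_cover[OF assms(2) tight])
next
  assume covers: "\<forall>(r :: 'a set rel) \<U>.
       uncountable_regular r \<and> relChain r \<U> \<and>
       (\<forall>i\<in>Field r. \<forall>U\<in>\<U> i. open U) \<and>
       open_Bs_cover \<BB> (\<Union>i\<in>Field r. \<U> i) \<longrightarrow>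
       (\<exists>i\<in>Field r. open_Bs_cover \<BB> (\<U> i))"
  show "countably_T_tight (strong_uniform_topology \<BB>)"
    unfolding countably_T_tight_def
  proof (intro allI impI, elim conjE)
    fix r :: "('a \<Rightarrow> real) rel" and A
    assume r: "uncountable_regular r" and chain: "relChain r A"
      and closed: "\<forall>i\<in>Field r. closedin (strong_uniform_topology \<BB>) (A i)"
    have "\<exists>i\<in>Field r. open_Bs_cover \<BB> (\<U> i)"
      if "relChain r \<U>" "\<And>i U. i \<in> Field r \<Longrightarrow> U \<in> \<U> i \<Longrightarrow> open U"
        "open_Bs_cover \<BB> (\<Union>i\<in>Field r. \<U> i)" for \<U>
      using _ r that by (rule regular_chain_cover) (use covers in metis)
    then show "closedin (strong_uniform_topology \<BB>) (\<Union>i\<in>Field r. A i)"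
      using chain_cover_imp_closed_Union[OF assms(2) r _ chain] closed by blast
  qed
qed

end
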